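(* Let $X=\coprod_{k>0}X_k$ and $Y=\coprod_{k>0}Y_k$ be coarse disjoint unions of finite connected graphs of strictly increasing diameter, where all $X_k$ are regular of one fixed degree and all $Y_k$ are regular of one fixed degree. Let $f:X\to Y$ be a coarse equivalence. Then $f$ induces a bijection between a co-finite set of components of $X$ and a co-finite set of components of $Y$: there are co-finite subsets $I,J\subset\mathbb{N}$ and a bijection $\alpha:I\to J$ such that $f(X_k)\subset Y_{\alpha(k)}$ for all $k\in I$. Moreover, there exists a constant $A>0$ such that, for every component $X_k$ of $X$ and all $x,x'\in X_k$, $$\frac{1}{A}d_X(x,x')-A\le d_Y(f(x),f(x'))\le A\cdot d_X(x,x').$$ In particular each $f|_{X_k}$ is an $(A,A)$-quasi-isometry (onto its image and, for $k\in I$, from $X_k$ to $Y_{\alpha(k)}$).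
   Context: A map $f:X\to Y$ of metric spaces is a coarse embedding if for all sequences $(x_n),(y_n)$ in $X$: $d_X(x_n,y_n)\to+\infty \iff d_Y(f(x_n),f(y_n))\to +\infty$. It is a coarse equivalence if moreover there is $R\ge 0$ such that $Y$ is the $R$-neighbourhood of $f(X)$. Coarse disjoint union: $X=\coprod_k X_k$ is endowed with a metric inducing the graph metric on each component $X_k$ and with $d(X_m,X_n)\ge\max\{\mathrm{diam}(X_m),\mathrm{diam}(X_n)\}$ for $m\neq n$. An $(A,A)$-quasi-isometry $g:Z\to W$ between metric spaces is a map with $\frac1A d(z,z')-A\le d(g(z),g(z'))\le A\,d(z,z')+A$ for all $z,z'\in Z$ and such that every point of $W$ is within distance $A$ of $g(Z)$. *)

theory Defs
  imports "HOL-Analysis.Abstract_Metric_Spaces" "HOL-Library.Disjoint_Sets"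
    "Graph_Theory.Graph_Theory"
begin

text \<open>
  A finite simple undirected graph is a \<^locale>\<open>graph\<close>: a finite, loop-free, symmetric digraph
  without parallel arcs.  Each undirected edge is a pair of opposite arcs, so the degree of a vertex
  is its out-degree, and the weight 1 on every arc makes the cost of a walk its length.
\<close>

definition regular :: "('a, 'b) pre_digraph \<Rightarrow> nat \<Rightarrow> bool" where
  "regular G D \<longleftrightarrow> (\<forall>v \<in> verts G. out_degree G v = D)"

definition graph_dist :: "('a, 'b) pre_digraph \<Rightarrow> 'a \<Rightarrow> 'a \<Rightarrow> real" where
  "graph_dist G u v = real_of_ereal (wf_digraph.\<mu> G (\<lambda>_. 1) u v)"

definition graph_diam :: "('a, 'b) pre_digraph \<Rightarrow> real" where
  "graph_diam G = (SUP (u, v) \<in> verts G \<times> verts G. graph_dist G u v)"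

definition set_dist :: "'a metric \<Rightarrow> 'a set \<Rightarrow> 'a set \<Rightarrow> real" where
  "set_dist m S T = (INF (x, y) \<in> S \<times> T. mdist m x y)"

text \<open>
  The disjoint union is internal: the vertex sets of the components \<open>G k\<close>, \<open>k > 0\<close>, are pairwise
  disjoint subsets of one type.  \<open>G 0\<close> plays no role.
\<close>

definition coarse_disjoint_union :: "(nat \<Rightarrow> ('a, 'b) pre_digraph) \<Rightarrow> 'a metric \<Rightarrow> bool" where
  "coarse_disjoint_union G m \<longleftrightarrow>
     disjoint_family_on (\<lambda>k. verts (G k)) {0<..} \<and>
     mspace m = (\<Union>k\<in>{0<..}. verts (G k)) \<and>
     (\<forall>k>0. \<forall>u \<in> verts (G k). \<forall>v \<in> verts (G k). mdist m u v = graph_dist (G k) u v) \<and>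
     (\<forall>i>0. \<forall>j>0. i \<noteq> j \<longrightarrow>
        set_dist m (verts (G i)) (verts (G j)) \<ge> max (graph_diam (G i)) (graph_diam (G j)))"

definition coarse_embedding :: "'a metric \<Rightarrow> 'b metric \<Rightarrow> ('a \<Rightarrow> 'b) \<Rightarrow> bool" where
  "coarse_embedding m1 m2 f \<longleftrightarrow>
     f \<in> mspace m1 \<rightarrow> mspace m2 \<and>
     (\<forall>x y :: nat \<Rightarrow> 'a. range x \<subseteq> mspace m1 \<longrightarrow> range y \<subseteq> mspace m1 \<longrightarrow>
        (filterlim (\<lambda>n. mdist m1 (x n) (y n)) at_top sequentially \<longleftrightarrow>
         filterlim (\<lambda>n. mdist m2 (f (x n)) (f (y n))) at_top sequentially))"

definition coarse_equivalence :: "'a metric \<Rightarrow> 'b metric \<Rightarrow> ('a \<Rightarrow> 'b) \<Rightarrow> bool" where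
  "coarse_equivalence m1 m2 f \<longleftrightarrow>
     coarse_embedding m1 m2 f \<and>
     (\<exists>R\<ge>0. \<forall>y \<in> mspace m2. \<exists>x \<in> mspace m1. mdist m2 (f x) y \<le> R)"

definition quasi_isometry :: "real \<Rightarrow> 'a metric \<Rightarrow> 'b metric \<Rightarrow> ('a \<Rightarrow> 'b) \<Rightarrow> bool" where
  "quasi_isometry A m1 m2 g \<longleftrightarrow>
     g \<in> mspace m1 \<rightarrow> mspace m2 \<and>
     (\<forall>z \<in> mspace m1. \<forall>z' \<in> mspace m1.
        1 / A * mdist m1 z z' - A \<le> mdist m2 (g z) (g z') \<and>
        mdist m2 (g z) (g z') \<le> A * mdist m1 z z' + A) \<and>
     (\<forall>w \<in> mspace m2. \<exists>z \<in> mspace m1. mdist m2 (g z) w \<le> A)"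

end

theory Submission
  imports Defs
begin

text \<open>
  Edges of a connected graph are the pairs at distance 1, so along geodesics a coarse map is
  Lipschitz on each component.  A component on which it does not stay in a single target component
  contains an edge whose end points are sent to different components at bounded distance; these
  target components have bounded diameter, hence are finitely many and have finitely many vertices,
  and each vertex has a bounded fibre, which meets only finitely many components.  Applying this to
  \<open>f\<close> and to a coarse inverse \<open>g\<close> gives maps \<open>\<alpha>\<close> and \<open>\<beta>\<close> on almost all indices;
  they are mutually inverse up to finite sets because \<open>g \<circ> f\<close> and \<open>f \<circ> g\<close> move points a
  bounded amount, and the Lipschitz bound for \<open>g\<close> is the lower bound for \<open>f\<close>.
\<close>

section \<open>Distances and diameters in finite connected graphs\<close>

text \<open>Trades arcs for a relation stated through distances alone, so that later inductions
  along a path need no graph structure. A single arc is a walk of cost 1, hence its ends are at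
  distance at most 1.\<close>

lemma (in graph) walk_relpowp:
  assumes "awalk u p v"
  shows "((\<lambda>a b. a \<in> verts G \<and> b \<in> verts G \<and> graph_dist G a b \<le> 1) ^^ length p) u v"
  using assms
proof (induction p arbitrary: u)
  case Nil
  then show ?case by (simp add: awalk_Nil_iff)
next
  case (Cons e p)
  then have e: "awalk u [e] (head G e)" and p: "awalk (head G e) p v"
    by (auto simp: awalk_simps)
  \<comment> \<open>\<open>\<mu>\<close> is an extended real; being attained by a walk makes it
    finite, so \<open>real_of_ereal\<close> preserves the inequality below.\<close>
  obtain q where q: "\<mu> (\<lambda>_. 1) u (head G e) = awalk_cost (\<lambda>_. 1) q"
    using min_cost_awalk[of u "head G e" "\<lambda>_. 1"] e by (auto simp: reachable_awalk)
  have "\<mu> (\<lambda>_. 1) u (head G e) \<le> awalk_cost (\<lambda>_. 1) [e]"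
    using e by (rule min_cost_le_walk_cost)
  then have "graph_dist G u (head G e) \<le> 1"
    unfolding graph_dist_def q by simp
  moreover have "u \<in> verts G" "head G e \<in> verts G"
    using e p by auto
  ultimately show ?case
    unfolding length_Cons using Cons.IH[OF p] by (blast intro: relpowp_Suc_I2)
qed

text \<open>A cheapest path exists, and with unit weights its cost counts its arcs. The integrality
  of distances obtained here drives the growth of the diameters.\<close>

lemma (in graph) graph_dist_geodesic:
  assumes "Digraph_Component.connected G" "u \<in> verts G" "v \<in> verts G"
  obtains n where "graph_dist G u v = real n"
    "((\<lambda>a b. a \<in> verts G \<and> b \<in> verts G \<and> graph_dist G a b \<le> 1) ^^ n) u v"
proof -
  have "u \<rightarrow>\<^sup>*\<^bsub>mk_symmetric G\<^esub> v"
    using assms unfolding Digraph_Component.connected_def strongly_connected_def by simp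
  \<comment> \<open>Connectedness refers to the symmetric closure, which has the same reachability
    as \<open>G\<close> because the arcs are already symmetric.\<close>
  then have "u \<rightarrow>\<^sup>* v"
    using reachable_mk_symmetric_eq sym_arcs by blast
  then obtain p where p: "apath u p v" "\<mu> (\<lambda>_. 1) u v = awalk_cost (\<lambda>_. 1) p"
    using min_cost_awalk[of u v "\<lambda>_. 1"] by auto
  have "awalk_cost (\<lambda>_. 1) p = real (length p)"
    unfolding awalk_cost_def by (induction p) auto
  then show thesis
    using that walk_relpowp p by (auto simp: graph_dist_def apath_def)
qed

text \<open>There are finitely many pairs of vertices, so the supremum is a maximum and inherits the
  integrality of distances.\<close>

lemma (in graph) graph_diam_attained:
  assumes "Digraph_Component.connected G"
  obtains n where "graph_diam G = real n"
proof -
  let ?S = "(\<lambda>(u, v). graph_dist G u v) ` (verts G \<times> verts G)"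
  have "verts G \<noteq> {}"
    using assms unfolding Digraph_Component.connected_def strongly_connected_def by simp
  then have S: "finite ?S" "?S \<noteq> {}" by auto
  then have "Sup ?S \<in> ?S"
    unfolding cSup_eq_Max[OF S] by (rule Max_in)
  then obtain u v where "u \<in> verts G" "v \<in> verts G" "graph_diam G = graph_dist G u v"
    unfolding graph_diam_def by auto
  then show thesis
    using that graph_dist_geodesic[OF assms] by metis
qed

text \<open>Strictly increasing integers grow by at least 1 at each index, so the diameters tend to
  infinity.\<close>

lemma finite_graph_diam_le:
  assumes graph: "\<And>k. k > 0 \<Longrightarrow> graph (G k)"
    and conn: "\<And>k. k > 0 \<Longrightarrow> Digraph_Component.connected (G k)"
    and mono: "strict_mono_on {0<..} (\<lambda>k. graph_diam (G k))"
  shows "finite {k :: nat. 0 < k \<and> graph_diam (G k) \<le> c}"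
proof -
  have diam: "\<exists>n. graph_diam (G k) = real n" if "k > 0" for k
    using graph.graph_diam_attained[OF graph conn] that by metis
  \<comment> \<open>Indices start at 1, so the linear bound is shifted by one; hence the
    \<open>Suc\<close> in the bound on \<open>k\<close> below.\<close>
  have "real k \<le> graph_diam (G (Suc k))" for k
  proof (induction k)
    case 0
    then show ?case using diam[of "Suc 0"] by auto
  next
    case (Suc k)
    have "graph_diam (G (Suc k)) < graph_diam (G (Suc (Suc k)))"
      using mono by (auto simp: strict_mono_on_def)
    then show ?case
      using Suc diam[of "Suc k"] diam[of "Suc (Suc k)"] by auto
  qed
  then have "k \<le> Suc (nat \<lceil>c\<rceil>)" if "0 < k" "graph_diam (G k) \<le> c" for k
    using that by (cases k) (auto, smt (verit) le_nat_iff of_nat_le_iff real_nat_ceiling_ge)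
  then have "{k. 0 < k \<and> graph_diam (G k) \<le> c} \<subseteq> {..Suc (nat \<lceil>c\<rceil>)}"
    by auto
  then show ?thesis
    by (rule finite_subset) simp
qed

section \<open>Spaces assembled from finite components\<close>

text \<open>Keeps the metric content of a coarse disjoint union and forgets the arcs.
  \<open>geodesic\<close> encodes connectedness together with the graph metric;
  \<open>finite_near_other\<close> is the separation: at each scale only finitely many components
  have another one nearby.\<close>

locale coarse_union =
  fixes V :: "nat \<Rightarrow> 'a set" and m :: "'a metric"
  assumes finite_component: "\<And>k. 0 < k \<Longrightarrow> finite (V k)"
    and nonempty_component: "\<And>k. 0 < k \<Longrightarrow> V k \<noteq> {}"
    and mspace_eq: "mspace m = (\<Union>k\<in>{0<..}. V k)"
    and geodesic: "\<And>k u v. 0 < k \<Longrightarrow> u \<in> V k \<Longrightarrow> v \<in> V k \<Longrightarrow>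
      \<exists>n. mdist m u v = real n \<and> ((\<lambda>a b. a \<in> V k \<and> b \<in> V k \<and> mdist m a b \<le> 1) ^^ n) u v"
    and finite_near_other:
      "\<And>c. finite {i. 0 < i \<and> (\<exists>u\<in>V i. \<exists>j>0. j \<noteq> i \<and> (\<exists>v\<in>V j. mdist m u v \<le> c))}"
begin

lemma component_subset: "0 < k \<Longrightarrow> V k \<subseteq> mspace m"
  by (auto simp: mspace_eq)

lemma component_obtain:
  assumes "x \<in> mspace m"
  obtains k where "0 < k" "x \<in> V k"
  using assms by (auto simp: mspace_eq)

text \<open>A geodesic from \<open>u\<close> to \<open>v\<close> has \<open>mdist m u v\<close>
  steps, and by the triangle inequality each contributes at most \<open>L\<close>.\<close>

lemma lipschitz_on_component:
  assumes "0 < k" "u \<in> V k" "v \<in> V k"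
    and h: "h \<in> V k \<rightarrow> mspace m'"
    and step: "\<And>a b. a \<in> V k \<Longrightarrow> b \<in> V k \<Longrightarrow> mdist m a b \<le> 1 \<Longrightarrow> mdist m' (h a) (h b) \<le> L"
  shows "mdist m' (h u) (h v) \<le> L * mdist m u v"
proof -
  obtain n where n: "mdist m u v = real n"
    and "((\<lambda>a b. a \<in> V k \<and> b \<in> V k \<and> mdist m a b \<le> 1) ^^ n) u v"
    using geodesic assms(1-3) by blast
  from this(2) \<open>v \<in> V k\<close> have "mdist m' (h u) (h v) \<le> L * real n"
  proof (induction n arbitrary: v)
    case 0
    then have "v = u" "h u \<in> mspace m'" using h by auto
    then have "mdist m' (h u) (h v) = 0" by simp
    then show ?case by simp
  next
    case (Suc n)
    then obtain w where w: "w \<in> V k" "mdist m w v \<le> 1"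
      and "((\<lambda>a b. a \<in> V k \<and> b \<in> V k \<and> mdist m a b \<le> 1) ^^ n) u w"
      by (auto elim: relpowp_Suc_E)
    then have "mdist m' (h u) (h w) \<le> L * real n" "mdist m' (h w) (h v) \<le> L"
      using Suc step by auto
    moreover have "mdist m' (h u) (h v) \<le> mdist m' (h u) (h w) + mdist m' (h w) (h v)"
      using h w Suc.prems \<open>u \<in> V k\<close> by (intro mdist_triangle) auto
    ultimately show ?case by (simp add: algebra_simps)
  qed
  then show ?thesis using n by simp
qed

text \<open>Connectedness as an induction principle; it will show that an image cannot leave its
  target component.\<close>

lemma component_induct:
  assumes "0 < k" "u \<in> V k" "v \<in> V k" "P u"
    and step: "\<And>a b. a \<in> V k \<Longrightarrow> b \<in> V k \<Longrightarrow> mdist m a b \<le> 1 \<Longrightarrow> P a \<Longrightarrow> P b"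
  shows "P v"
proof -
  obtain n where "((\<lambda>a b. a \<in> V k \<and> b \<in> V k \<and> mdist m a b \<le> 1) ^^ n) u v"
    using geodesic assms(1-3) by blast
  then show ?thesis
  proof (induction n arbitrary: v)
    case 0
    then show ?case using \<open>P u\<close> by simp
  next
    case (Suc n)
    then show ?case by (auto elim!: relpowp_Suc_E intro: step)
  qed
qed

text \<open>Apart from the component of \<open>x\<close>, every component counted here is within
  \<open>c\<close> of another one, namely that of \<open>x\<close>.\<close>

lemma finite_components_near:
  assumes "x \<in> mspace m"
  shows "finite {k. 0 < k \<and> (\<exists>y\<in>V k. mdist m x y \<le> c)}"
proof -
  obtain i where i: "0 < i" "x \<in> V i"
    using assms by (rule component_obtain)
  have "{k. 0 < k \<and> (\<exists>y\<in>V k. mdist m x y \<le> c)} \<subseteq>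
      insert i {k. 0 < k \<and> (\<exists>u\<in>V k. \<exists>j>0. j \<noteq> k \<and> (\<exists>v\<in>V j. mdist m u v \<le> c))}"
    using i by (auto simp: mdist_commute)
  then show ?thesis
    by (rule finite_subset) (simp add: finite_near_other)
qed

end

text \<open>The distance between distinct components dominates both diameters, so a component within
  \<open>c\<close> of another has diameter at most \<open>c\<close>, and only finitely many
  do.\<close>

lemma coarse_union_graphs:
  assumes graph: "\<And>k. k > 0 \<Longrightarrow> graph (G k)"
    and conn: "\<And>k. k > 0 \<Longrightarrow> Digraph_Component.connected (G k)"
    and mono: "strict_mono_on {0<..} (\<lambda>k. graph_diam (G k))"
    and union: "coarse_disjoint_union G m"
  shows "coarse_union (\<lambda>k. verts (G k)) m"
proof
  fix k :: nat assume "0 < k"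
  show "finite (verts (G k))"
  proof -
    interpret graph "G k" using graph \<open>0 < k\<close> .
    show ?thesis by simp
  qed
  show "verts (G k) \<noteq> {}"
    using conn \<open>0 < k\<close> unfolding Digraph_Component.connected_def strongly_connected_def by force
next
  show "mspace m = (\<Union>k\<in>{0<..}. verts (G k))"
    using union by (simp add: coarse_disjoint_union_def)
next
  fix k u v assume k: "0 < k" and uv: "u \<in> verts (G k)" "v \<in> verts (G k)"
  have dist: "mdist m a b = graph_dist (G k) a b" if "a \<in> verts (G k)" "b \<in> verts (G k)" for a b
    using union k that by (auto simp: coarse_disjoint_union_def)
  \<comment> \<open>The two distances are known to agree on vertices of \<open>G k\<close>; the
    membership conditions in the step relation therefore make both relations equal.\<close>
  have "(\<lambda>a b. a \<in> verts (G k) \<and> b \<in> verts (G k) \<and> mdist m a b \<le> 1) =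
      (\<lambda>a b. a \<in> verts (G k) \<and> b \<in> verts (G k) \<and> graph_dist (G k) a b \<le> 1)"
    using dist by (auto simp: fun_eq_iff)
  moreover obtain n where "graph_dist (G k) u v = real n"
    "((\<lambda>a b. a \<in> verts (G k) \<and> b \<in> verts (G k) \<and> graph_dist (G k) a b \<le> 1) ^^ n) u v"
    by (rule graph.graph_dist_geodesic[OF graph[OF k] conn[OF k] uv])
  ultimately show "\<exists>n. mdist m u v = real n \<and>
      ((\<lambda>a b. a \<in> verts (G k) \<and> b \<in> verts (G k) \<and> mdist m a b \<le> 1) ^^ n) u v"
    using dist[OF uv] by auto
next
  fix c
  have "graph_diam (G i) \<le> c"
    if ij: "0 < i" "0 < j" "j \<noteq> i" and uv: "u \<in> verts (G i)" "v \<in> verts (G j)" "mdist m u v \<le> c"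
    for i j u v
  proof -
    have "graph_diam (G i) \<le> set_dist m (verts (G i)) (verts (G j))"
      using union ij by (fastforce simp: coarse_disjoint_union_def)
    also have "\<dots> \<le> mdist m u v"
      unfolding set_dist_def
      using uv by (intro cINF_lower2[where x = "(u, v)"] bdd_belowI[where m = 0]) auto
    finally show ?thesis using uv by simp
  qed
  then show "finite {i. 0 < i \<and>
      (\<exists>u\<in>verts (G i). \<exists>j>0. j \<noteq> i \<and> (\<exists>v\<in>verts (G j). mdist m u v \<le> c))}"
    by (intro finite_subset[OF _ finite_graph_diam_le[OF graph conn mono, of c]]) auto
qed

section \<open>Coarse maps with a coarse inverse\<close>

text \<open>One constant \<open>C\<close> serves all four estimates, and the assumptions are
  symmetric in \<open>f\<close> and \<open>g\<close>, so every result about \<open>f\<close>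
  transfers to \<open>g\<close> through \<open>swap\<close>.\<close>

locale coarse_inverse = X: coarse_union V m + Y: coarse_union W m'
  for V :: "nat \<Rightarrow> 'a set" and m W and m' :: "'c metric" +
  fixes f :: "'a \<Rightarrow> 'c" and g :: "'c \<Rightarrow> 'a" and C :: real
  assumes f_mspace: "f \<in> mspace m \<rightarrow> mspace m'"
    and g_mspace: "g \<in> mspace m' \<rightarrow> mspace m"
    and f_step: "\<And>a b. a \<in> mspace m \<Longrightarrow> b \<in> mspace m \<Longrightarrow> mdist m a b \<le> 1 \<Longrightarrow>
      mdist m' (f a) (f b) \<le> C"
    and g_step: "\<And>a b. a \<in> mspace m' \<Longrightarrow> b \<in> mspace m' \<Longrightarrow> mdist m' a b \<le> 1 \<Longrightarrow>
      mdist m (g a) (g b) \<le> C"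
    and gf: "\<And>x. x \<in> mspace m \<Longrightarrow> mdist m (g (f x)) x \<le> C"
    and fg: "\<And>y. y \<in> mspace m' \<Longrightarrow> mdist m' (f (g y)) y \<le> C"
begin

lemma swap: "coarse_inverse W m' V m g f C"
  by unfold_locales (fact f_mspace g_mspace f_step g_step gf fg)+

lemma f_lipschitz:
  assumes "0 < k" "x \<in> V k" "x' \<in> V k"
  shows "mdist m' (f x) (f x') \<le> C * mdist m x x'"
proof (rule X.lipschitz_on_component[OF assms])
  note V = X.component_subset[OF \<open>0 < k\<close>]
  show "f \<in> V k \<rightarrow> mspace m'" using V f_mspace by auto
  show "mdist m' (f a) (f b) \<le> C" if "a \<in> V k" "b \<in> V k" "mdist m a b \<le> 1" for a b
    using f_step that V by blast
qed

text \<open>The fibre of \<open>f\<close> over \<open>y\<close> lies within \<open>C\<close> of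
  \<open>g y\<close>, hence meets finitely many components; \<open>W j\<close> has finitely many
  points \<open>y\<close>.\<close>

lemma finite_meeting_component:
  assumes "0 < j"
  shows "finite {k. 0 < k \<and> f ` V k \<inter> W j \<noteq> {}}"
proof -
  have "finite {k. 0 < k \<and> (\<exists>x\<in>V k. f x = y)}" if "y \<in> W j" for y
  proof (rule finite_subset)
    have y: "y \<in> mspace m'" using that Y.component_subset assms by auto
    then have "g y \<in> mspace m" using g_mspace by auto
    then show "finite {k. 0 < k \<and> (\<exists>x\<in>V k. mdist m (g y) x \<le> C)}"
      by (rule X.finite_components_near)
    show "{k. 0 < k \<and> (\<exists>x\<in>V k. f x = y)} \<subseteq> {k. 0 < k \<and> (\<exists>x\<in>V k. mdist m (g y) x \<le> C)}"
      using gf X.component_subset by blast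
  qed
  moreover have "{k. 0 < k \<and> f ` V k \<inter> W j \<noteq> {}} = (\<Union>y\<in>W j. {k. 0 < k \<and> (\<exists>x\<in>V k. f x = y)})"
    by auto
  ultimately show ?thesis
    using Y.finite_component assms by simp
qed

text \<open>Finitely many target components are within \<open>C\<close> of another one, and each is
  met by finitely many images. An image avoiding all of them cannot change component along a unit
  step.\<close>

lemma finite_split_component:
  "finite {k. 0 < k \<and> \<not> (\<exists>j>0. f ` V k \<subseteq> W j)}"
proof -
  define N where "N = {i. 0 < i \<and> (\<exists>u\<in>W i. \<exists>j>0. j \<noteq> i \<and> (\<exists>v\<in>W j. mdist m' u v \<le> C))}"
  have "finite (\<Union>j\<in>N. {k. 0 < k \<and> f ` V k \<inter> W j \<noteq> {}})"
    using finite_meeting_component Y.finite_near_other[of C] by (auto simp: N_def)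
  moreover have "{k. 0 < k \<and> \<not> (\<exists>j>0. f ` V k \<subseteq> W j)} \<subseteq> (\<Union>j\<in>N. {k. 0 < k \<and> f ` V k \<inter> W j \<noteq> {}})"
  proof (intro subsetI, rule ccontr)
    fix k assume "k \<in> {k. 0 < k \<and> \<not> (\<exists>j>0. f ` V k \<subseteq> W j)}"
      and not_near: "k \<notin> (\<Union>j\<in>N. {k. 0 < k \<and> f ` V k \<inter> W j \<noteq> {}})"
    then have k: "0 < k" and split: "\<not> (\<exists>j>0. f ` V k \<subseteq> W j)"
      by simp_all
    have far: "f ` V k \<inter> W j = {}" if "j \<in> N" for j
      using that not_near k by blast
    obtain x where x: "x \<in> V k" using X.nonempty_component k by auto
    then have "f x \<in> mspace m'" using f_mspace X.component_subset k by blast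
    then obtain j where j: "0 < j" "f x \<in> W j" by (rule Y.component_obtain)
    \<comment> \<open>Spread along unit steps: if \<open>f b\<close> lay outside \<open>W j\<close>,
      then \<open>W j\<close> would be within \<open>C\<close> of another component, so
      \<open>j\<close> would belong to \<open>N\<close> although \<open>f\<close> maps
      \<open>a\<close> into \<open>W j\<close>.\<close>
    have "f y \<in> W j" if "y \<in> V k" for y
    proof (rule X.component_induct[of k x y "\<lambda>y. f y \<in> W j"])
      fix a b assume ab: "a \<in> V k" "b \<in> V k" "mdist m a b \<le> 1" "f a \<in> W j"
      then have ab': "a \<in> mspace m" "b \<in> mspace m" using X.component_subset k by auto
      then have "f b \<in> mspace m'" using f_mspace by auto
      then obtain i where i: "0 < i" "f b \<in> W i" by (rule Y.component_obtain)
      have "mdist m' (f a) (f b) \<le> C" using f_step ab ab' by blast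
      then have "j \<in> N" if "i \<noteq> j" unfolding N_def using ab i j that by blast
      then have "i = j" using far[of j] ab by blast
      then show "f b \<in> W j" using i by simp
    qed (use k x j that in auto)
    then have "f ` V k \<subseteq> W j" by blast
    then show False using split j by blast
  qed
  ultimately show ?thesis by (rule finite_subset[rotated])
qed

lemma component_map:
  obtains \<alpha> where "finite {k. 0 < k \<and> \<not> (0 < \<alpha> k \<and> f ` V k \<subseteq> W (\<alpha> k))}"
proof
  \<comment> \<open>The choice is arbitrary where no target component contains the image, which
    happens for finitely many indices.\<close>
  let ?\<alpha> = "\<lambda>k. SOME j. 0 < j \<and> f ` V k \<subseteq> W j"
  have "0 < ?\<alpha> k \<and> f ` V k \<subseteq> W (?\<alpha> k)" if "\<exists>j>0. f ` V k \<subseteq> W j" for k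
    using that by (rule someI_ex)
  then show "finite {k. 0 < k \<and> \<not> (0 < ?\<alpha> k \<and> f ` V k \<subseteq> W (?\<alpha> k))}"
    by (intro finite_subset[OF _ finite_split_component]) blast
qed

text \<open>The conditions are symmetric under exchanging \<open>(f, \<alpha>)\<close> with
  \<open>(g, \<beta>)\<close>, so \<open>\<alpha>\<close> maps this set bijectively onto its
  counterpart for \<open>g\<close>, with inverse \<open>\<beta>\<close>.\<close>

definition matched :: "(nat \<Rightarrow> nat) \<Rightarrow> (nat \<Rightarrow> nat) \<Rightarrow> nat set" where
  "matched \<alpha> \<beta> = {k. 0 < k \<and> 0 < \<alpha> k \<and> f ` V k \<subseteq> W (\<alpha> k) \<and> g ` W (\<alpha> k) \<subseteq> V k \<and> \<beta> (\<alpha> k) = k}"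

text \<open>Three finite exceptional sets suffice: \<open>\<alpha>\<close> fails at
  \<open>k\<close>; \<open>f\<close> sends a point of \<open>V k\<close> into a component where
  \<open>\<beta>\<close> fails; or \<open>V k\<close> has a point within \<open>C\<close> of another
  component.\<close>

lemma cofinite_matched:
  assumes \<alpha>: "finite {k. 0 < k \<and> \<not> (0 < \<alpha> k \<and> f ` V k \<subseteq> W (\<alpha> k))}" (is "finite ?A")
    and \<beta>: "finite {j. 0 < j \<and> \<not> (0 < \<beta> j \<and> g ` W j \<subseteq> V (\<beta> j))}" (is "finite ?B")
  shows "finite ({0<..} - matched \<alpha> \<beta>)"
proof (rule finite_subset)
  let ?N = "{i. 0 < i \<and> (\<exists>u\<in>V i. \<exists>j>0. j \<noteq> i \<and> (\<exists>v\<in>V j. mdist m u v \<le> C))}"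
  let ?P = "\<Union>j\<in>?B. {k. 0 < k \<and> f ` V k \<inter> W j \<noteq> {}}"
  have "finite ?P" using \<beta> finite_meeting_component by blast
  then show "finite (?A \<union> ?P \<union> ?N)" using \<alpha> X.finite_near_other by blast
  show "{0<..} - matched \<alpha> \<beta> \<subseteq> ?A \<union> ?P \<union> ?N"
  proof (intro subsetI, rule ccontr)
    fix k assume "k \<in> {0<..} - matched \<alpha> \<beta>" "k \<notin> ?A \<union> ?P \<union> ?N"
    then have k: "0 < k" "k \<notin> matched \<alpha> \<beta>" "k \<notin> ?A" "k \<notin> ?P" "k \<notin> ?N"
      by (simp_all only: Un_iff Diff_iff greaterThan_iff de_Morgan_disj not_False_eq_True)
    then have \<alpha>k: "0 < \<alpha> k" "f ` V k \<subseteq> W (\<alpha> k)" by auto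
    obtain x where x: "x \<in> V k" using X.nonempty_component[OF k(1)] by blast
    then have "\<alpha> k \<notin> ?B" using k(1,4) \<alpha>k(2) by blast
    then have \<beta>k: "0 < \<beta> (\<alpha> k)" "g ` W (\<alpha> k) \<subseteq> V (\<beta> (\<alpha> k))" using \<alpha>k by auto
    then have "g (f x) \<in> V (\<beta> (\<alpha> k))" using x \<alpha>k(2) by blast
    moreover have "x \<in> mspace m" using X.component_subset[OF k(1)] x by blast
    then have "mdist m x (g (f x)) \<le> C"
      using gf[of x] mdist_commute[of m x "g (f x)"] by simp
    \<comment> \<open>Otherwise \<open>g (f x)\<close> would lie in another component within
      \<open>C\<close> of \<open>x\<close>, putting \<open>k\<close> into \<open>?N\<close>.\<close>
    ultimately have "\<beta> (\<alpha> k) = k" using k(1,5) x \<beta>k(1) by blast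
    then show False using k(1,2) \<alpha>k \<beta>k by (simp add: matched_def)
  qed
qed

text \<open>Both images lie in the single component \<open>W (\<alpha> k)\<close>, so the Lipschitz
  bound of \<open>g\<close> applies to them; replacing \<open>x\<close> and \<open>x'\<close> by
  their images under \<open>g \<circ> f\<close> costs \<open>C\<close> each.\<close>

lemma lower_bound_matched:
  assumes "k \<in> matched \<alpha> \<beta>" "x \<in> V k" "x' \<in> V k"
  shows "mdist m x x' \<le> 2 * C + C * mdist m' (f x) (f x')"
proof -
  interpret G: coarse_inverse W m' V m g f C by (rule swap)
  have k: "0 < k" "0 < \<alpha> k" "f x \<in> W (\<alpha> k)" "f x' \<in> W (\<alpha> k)"
    using assms by (auto simp: matched_def)
  have x: "x \<in> mspace m" "x' \<in> mspace m"
    using assms k X.component_subset by auto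
  then have gfx: "g (f x) \<in> mspace m" "g (f x') \<in> mspace m"
    using f_mspace g_mspace by auto
  have "mdist m x x' \<le> mdist m x (g (f x)) + mdist m (g (f x)) x'"
    using x gfx by (intro mdist_triangle)
  also have "mdist m (g (f x)) x' \<le> mdist m (g (f x)) (g (f x')) + mdist m (g (f x')) x'"
    using x gfx by (intro mdist_triangle)
  also have "mdist m (g (f x)) (g (f x')) \<le> C * mdist m' (f x) (f x')"
    using G.f_lipschitz k by blast
  finally show ?thesis
    using gf[OF x(1)] gf[OF x(2)] mdist_commute[of m x "g (f x)"] by simp
qed

end

section \<open>From sequences to uniform bounds and a coarse inverse\<close>

text \<open>If \<open>q\<close> were unbounded where \<open>p \<le> R\<close>, pairs with
  \<open>q\<close> at least \<open>n\<close> would form sequences along which \<open>q\<close>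
  diverges but \<open>p\<close> does not. With \<open>p\<close> and \<open>q\<close> abstract, both
  directions of a coarse embedding are covered.\<close>

lemma coarse_transfer:
  fixes p q :: "'a \<Rightarrow> 'a \<Rightarrow> real"
  assumes "\<And>x y :: nat \<Rightarrow> 'a. range x \<subseteq> M \<Longrightarrow> range y \<subseteq> M \<Longrightarrow>
      filterlim (\<lambda>n. q (x n) (y n)) at_top sequentially \<Longrightarrow>
      filterlim (\<lambda>n. p (x n) (y n)) at_top sequentially"
  shows "\<exists>S. \<forall>x\<in>M. \<forall>y\<in>M. p x y \<le> R \<longrightarrow> q x y \<le> S"
proof (rule ccontr)
  assume "\<not> ?thesis"
  then have "\<forall>n. \<exists>x y. x \<in> M \<and> y \<in> M \<and> p x y \<le> R \<and> real n \<le> q x y"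
    by (meson linear)
  then obtain x y where xy: "\<And>n. x n \<in> M \<and> y n \<in> M \<and> p (x n) (y n) \<le> R \<and> real n \<le> q (x n) (y n)"
    by metis
  have "filterlim (\<lambda>n. q (x n) (y n)) at_top sequentially"
    using xy by (intro filterlim_at_top_mono[OF filterlim_real_sequentially]) auto
  then have "filterlim (\<lambda>n. p (x n) (y n)) at_top sequentially"
    using xy by (intro assms) auto
  then have "eventually (\<lambda>n. R + 1 \<le> p (x n) (y n)) sequentially"
    by (simp add: filterlim_at_top)
  then obtain n where "R + 1 \<le> p (x n) (y n)"
    by (auto simp: eventually_sequentially)
  then show False using xy[of n] by auto
qed

lemma coarse_embedding_bounds:
  assumes "coarse_embedding m m' f"
  obtains S T where
    "\<And>x y. x \<in> mspace m \<Longrightarrow> y \<in> mspace m \<Longrightarrow> mdist m x y \<le> R \<Longrightarrow> mdist m' (f x) (f y) \<le> S"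
    "\<And>x y. x \<in> mspace m \<Longrightarrow> y \<in> mspace m \<Longrightarrow> mdist m' (f x) (f y) \<le> R \<Longrightarrow> mdist m x y \<le> T"
proof -
  have iff: "filterlim (\<lambda>n. mdist m (x n) (y n)) at_top sequentially \<longleftrightarrow>
      filterlim (\<lambda>n. mdist m' (f (x n)) (f (y n))) at_top sequentially"
    if "range x \<subseteq> mspace m" "range y \<subseteq> mspace m" for x y :: "nat \<Rightarrow> 'a"
    using assms that by (auto simp: coarse_embedding_def)
  have "\<exists>S. \<forall>x\<in>mspace m. \<forall>y\<in>mspace m. mdist m x y \<le> R \<longrightarrow> mdist m' (f x) (f y) \<le> S"
    by (rule coarse_transfer) (simp add: iff)
  moreover have "\<exists>T. \<forall>x\<in>mspace m. \<forall>y\<in>mspace m. mdist m' (f x) (f y) \<le> R \<longrightarrow> mdist m x y \<le> T"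
    by (rule coarse_transfer) (simp add: iff)
  ultimately show thesis using that by blast
qed

lemma quasi_isometry_submetric:
  assumes "S \<subseteq> mspace m" "T \<subseteq> mspace m'" "h ` S \<subseteq> T"
    and "\<And>x x'. x \<in> S \<Longrightarrow> x' \<in> S \<Longrightarrow> 1 / A * mdist m x x' - A \<le> mdist m' (h x) (h x')"
    and "\<And>x x'. x \<in> S \<Longrightarrow> x' \<in> S \<Longrightarrow> mdist m' (h x) (h x') \<le> A * mdist m x x' + A"
    and "\<And>w. w \<in> T \<Longrightarrow> \<exists>z\<in>S. mdist m' (h z) w \<le> A"
  shows "quasi_isometry A (submetric m S) (submetric m' T) h"
proof -
  have "S \<inter> mspace m = S" "T \<inter> mspace m' = T" using assms(1,2) by auto
  then show ?thesis
    using assms(3-) unfolding quasi_isometry_def by (simp add: image_subset_iff_funcset)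
qed

text \<open>\<open>g\<close> chooses for each \<open>y\<close> a point whose image is within
  \<open>R\<close> of \<open>y\<close>; its estimates are pulled back through
  \<open>f\<close>.\<close>

lemma coarse_equivalence_inverse:
  assumes V: "coarse_union V m" and W: "coarse_union W m'"
    and f: "coarse_equivalence m m' f"
  obtains g C where "coarse_inverse V m W m' f g C"
proof -
  have emb: "coarse_embedding m m' f" and f_mspace: "f \<in> mspace m \<rightarrow> mspace m'"
    using f by (auto simp: coarse_equivalence_def coarse_embedding_def)
  obtain R where R: "0 \<le> R" "\<And>y. y \<in> mspace m' \<Longrightarrow> \<exists>x\<in>mspace m. mdist m' (f x) y \<le> R"
    using f by (auto simp: coarse_equivalence_def)
  then obtain g where g: "\<And>y. y \<in> mspace m' \<Longrightarrow> g y \<in> mspace m"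
    and fg: "\<And>y. y \<in> mspace m' \<Longrightarrow> mdist m' (f (g y)) y \<le> R"
    by metis
  \<comment> \<open>The scale \<open>2 * R + 1\<close> is that of a unit step with both ends
    displaced by \<open>R\<close>; it also exceeds 1 and \<open>R\<close>, as needed for
    \<open>f_step\<close> and \<open>gf\<close>.\<close>
  obtain S T where
    S: "\<And>x y. x \<in> mspace m \<Longrightarrow> y \<in> mspace m \<Longrightarrow> mdist m x y \<le> 2 * R + 1 \<Longrightarrow>
      mdist m' (f x) (f y) \<le> S" and
    T: "\<And>x y. x \<in> mspace m \<Longrightarrow> y \<in> mspace m \<Longrightarrow> mdist m' (f x) (f y) \<le> 2 * R + 1 \<Longrightarrow>
      mdist m x y \<le> T"
    by (rule coarse_embedding_bounds[OF emb, of "2 * R + 1"]) blast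
  define C where "C = max R (max S T)"
  have "mdist m' (f (g a)) (f (g b)) \<le> 2 * R + 1"
    if ab: "a \<in> mspace m'" "b \<in> mspace m'" "mdist m' a b \<le> 1" for a b
  proof -
    have fgab: "f (g a) \<in> mspace m'" "f (g b) \<in> mspace m'"
      using g ab f_mspace by auto
    have "mdist m' (f (g a)) (f (g b)) \<le> mdist m' (f (g a)) a + mdist m' a (f (g b))"
      using fgab ab by (intro mdist_triangle)
    also have "mdist m' a (f (g b)) \<le> mdist m' a b + mdist m' b (f (g b))"
      using fgab ab by (intro mdist_triangle)
    finally show ?thesis
      using fg[OF ab(1)] fg[OF ab(2)] ab(3) mdist_commute[of m' b "f (g b)"] by simp
  qed
  then have g_step: "mdist m (g a) (g b) \<le> T"
    if "a \<in> mspace m'" "b \<in> mspace m'" "mdist m' a b \<le> 1" for a b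
    using that by (intro T g) auto
  \<comment> \<open>\<open>f (g (f x))\<close> is within \<open>R\<close> of \<open>f x\<close>, and
    \<open>T\<close> pulls this back to \<open>g (f x)\<close> and \<open>x\<close>.\<close>
  have gf: "mdist m (g (f x)) x \<le> T" if "x \<in> mspace m" for x
  proof -
    have "f x \<in> mspace m'" using f_mspace that by auto
    then show ?thesis
      using fg[of "f x"] g R that by (intro T) auto
  qed
  interpret V: coarse_union V m by (rule V)
  interpret W: coarse_union W m' by (rule W)
  have "coarse_inverse V m W m' f g C"
  proof
    show "f \<in> mspace m \<rightarrow> mspace m'" by (rule f_mspace)
    show "g \<in> mspace m' \<rightarrow> mspace m" using g by auto
    show "mdist m' (f a) (f b) \<le> C"
      if "a \<in> mspace m" "b \<in> mspace m" "mdist m a b \<le> 1" for a b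
      using S[of a b] that R by (simp add: C_def)
    show "mdist m (g a) (g b) \<le> C"
      if "a \<in> mspace m'" "b \<in> mspace m'" "mdist m' a b \<le> 1" for a b
      using g_step[of a b] that by (simp add: C_def)
    show "mdist m (g (f x)) x \<le> C" if "x \<in> mspace m" for x
      using gf[of x] that by (simp add: C_def)
    show "mdist m' (f (g y)) y \<le> C" if "y \<in> mspace m'" for y
      using fg[of y] that by (simp add: C_def)
  qed
  then show thesis by (rule that)
qed

section \<open>The bijection of components and the common constant\<close>

theorem lemma1:
  fixes X :: "nat \<Rightarrow> ('a, 'b) pre_digraph" and Y :: "nat \<Rightarrow> ('c, 'd) pre_digraph"
    and mX :: "'a metric" and mY :: "'c metric"
    and D\<^sub>X D\<^sub>Y :: nat and f :: "'a \<Rightarrow> 'c"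
  assumes "\<And>k. k > 0 \<Longrightarrow> graph (X k)"
    and "\<And>k. k > 0 \<Longrightarrow> Digraph_Component.connected (X k)"
    and "\<And>k. k > 0 \<Longrightarrow> regular (X k) D\<^sub>X"
    and "strict_mono_on {0<..} (\<lambda>k. graph_diam (X k))"
    and "coarse_disjoint_union X mX"
    and "\<And>k. k > 0 \<Longrightarrow> graph (Y k)"
    and "\<And>k. k > 0 \<Longrightarrow> Digraph_Component.connected (Y k)"
    and "\<And>k. k > 0 \<Longrightarrow> regular (Y k) D\<^sub>Y"
    and "strict_mono_on {0<..} (\<lambda>k. graph_diam (Y k))"
    and "coarse_disjoint_union Y mY"
    and "coarse_equivalence mX mY f"
  shows "\<exists>I J \<alpha>.
    I \<subseteq> {0<..} \<and> finite ({0<..} - I) \<and>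
    J \<subseteq> {0<..} \<and> finite ({0<..} - J) \<and>
    bij_betw \<alpha> I J \<and>
    (\<forall>k\<in>I. f ` verts (X k) \<subseteq> verts (Y (\<alpha> k))) \<and>
    (\<exists>A>0.
      (\<forall>k>0. \<forall>x \<in> verts (X k). \<forall>x' \<in> verts (X k).
         1 / A * mdist mX x x' - A \<le> mdist mY (f x) (f x') \<and>
         mdist mY (f x) (f x') \<le> A * mdist mX x x') \<and>
      (\<forall>k>0. quasi_isometry A (submetric mX (verts (X k))) (submetric mY (f ` verts (X k))) f) \<and>
      (\<forall>k\<in>I. quasi_isometry A (submetric mX (verts (X k))) (submetric mY (verts (Y (\<alpha> k)))) f))"
proof -
  let ?V = "\<lambda>k. verts (X k)" and ?W = "\<lambda>k. verts (Y k)"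
  obtain g C where "coarse_inverse ?V mX ?W mY f g C"
    by (rule coarse_equivalence_inverse[OF coarse_union_graphs[OF assms(1,2,4,5)]
          coarse_union_graphs[OF assms(6,7,9,10)] assms(11)])
  then interpret F: coarse_inverse ?V mX ?W mY f g C .
  interpret G: coarse_inverse ?W mY ?V mX g f C by (rule F.swap)
  obtain \<alpha> where \<alpha>: "finite {k. 0 < k \<and> \<not> (0 < \<alpha> k \<and> f ` ?V k \<subseteq> ?W (\<alpha> k))}"
    by (rule F.component_map)
  obtain \<beta> where \<beta>: "finite {j. 0 < j \<and> \<not> (0 < \<beta> j \<and> g ` ?W j \<subseteq> ?V (\<beta> j))}"
    by (rule G.component_map)
  define I where "I = F.matched \<alpha> \<beta>"
  define J where "J = G.matched \<beta> \<alpha>"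
  have I: "finite ({0<..} - I)" unfolding I_def using \<alpha> \<beta> by (rule F.cofinite_matched)
  have J: "finite ({0<..} - J)" unfolding J_def using \<beta> \<alpha> by (rule G.cofinite_matched)
  have bij: "bij_betw \<alpha> I J"
    by (rule bij_betwI[where g = \<beta>]) (auto simp: I_def J_def F.matched_def G.matched_def)
  have sub: "I \<subseteq> {0<..}" "J \<subseteq> {0<..}"
    by (auto simp: I_def J_def F.matched_def G.matched_def)
  have images: "f ` ?V k \<subseteq> ?W (\<alpha> k)" "g ` ?W (\<alpha> k) \<subseteq> ?V k" "0 < \<alpha> k" if "k \<in> I" for k
    using that by (auto simp: I_def F.matched_def)
  \<comment> \<open>Distances inside the finitely many finite components outside \<open>I\<close>; a
    bound on them lets the additive constant absorb the lower estimate there.\<close>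
  let ?D = "\<Union>k\<in>{0<..} - I. (\<lambda>(x, x'). mdist mX x x') ` (?V k \<times> ?V k)"
  have "finite ?D" using I F.X.finite_component by auto
  then obtain M where M: "\<And>d. d \<in> ?D \<Longrightarrow> d \<le> M"
    using bdd_above_finite by (meson bdd_above.E)
  \<comment> \<open>\<open>C\<close> is the Lipschitz constant, \<open>2 * C\<close> the additive
    loss on \<open>I\<close>, \<open>M\<close> the loss off \<open>I\<close>, and 1 permits division
    by \<open>A\<close>; absolute values cover all signs of \<open>C\<close> and
    \<open>M\<close>.\<close>
  define A where "A = 1 + 2 * \<bar>C\<bar> + \<bar>M\<bar>"
  have A: "1 \<le> A" "2 * C \<le> A" "C \<le> A" "M \<le> A" by (auto simp: A_def)
  have upper: "mdist mY (f x) (f x') \<le> A * mdist mX x x'"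
    if "0 < k" "x \<in> ?V k" "x' \<in> ?V k" for k x x'
    using F.f_lipschitz[OF that] mult_right_mono[OF \<open>C \<le> A\<close>, of "mdist mX x x'"] by simp
  have lower: "1 / A * mdist mX x x' - A \<le> mdist mY (f x) (f x')"
    if "0 < k" "x \<in> ?V k" "x' \<in> ?V k" for k x x'
  proof -
    \<comment> \<open>Dividing this by \<open>A\<close> leaves an additive error 1, which is at most
      \<open>A\<close>.\<close>
    have "mdist mX x x' \<le> A + A * mdist mY (f x) (f x')"
    proof (cases "k \<in> I")
      case True
      then have "mdist mX x x' \<le> 2 * C + C * mdist mY (f x) (f x')"
        unfolding I_def using that by (intro F.lower_bound_matched)
      then show ?thesis
        using A mult_right_mono[OF \<open>C \<le> A\<close>, of "mdist mY (f x) (f x')"] by simp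
    next
      case False
      then have "mdist mX x x' \<in> ?D" using that by force
      then have "mdist mX x x' \<le> A" using M A by fastforce
      moreover have "0 \<le> A * mdist mY (f x) (f x')" using A by simp
      ultimately show ?thesis by linarith
    qed
    then have "mdist mX x x' / A \<le> 1 + mdist mY (f x) (f x')"
      using A by (simp add: field_simps)
    then show ?thesis using A by simp
  qed
  have V: "?V k \<subseteq> mspace mX" "f ` ?V k \<subseteq> mspace mY" if "0 < k" for k
    using F.X.component_subset F.f_mspace that by blast+
  have affine: "mdist mY (f x) (f x') \<le> A * mdist mX x x' + A"
    if "0 < k" "x \<in> ?V k" "x' \<in> ?V k" for k x x'
    using upper[OF that] A by simp
  have onto_image: "quasi_isometry A (submetric mX (?V k)) (submetric mY (f ` ?V k)) f"
    if "0 < k" for k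
  proof (rule quasi_isometry_submetric[OF V[OF that] order_refl lower[OF that] affine[OF that]])
    fix w assume "w \<in> f ` ?V k"
    then obtain z where z: "z \<in> ?V k" "w = f z" by blast
    then have "w \<in> mspace mY" using V[OF that] by blast
    then have "mdist mY (f z) w = 0" using z by simp
    then show "\<exists>z\<in>?V k. mdist mY (f z) w \<le> A" using z A by (intro bexI[of _ z]) auto
  qed
  have onto_component: "quasi_isometry A (submetric mX (?V k)) (submetric mY (?W (\<alpha> k))) f"
    if "k \<in> I" for k
  proof -
    have k: "0 < k" using sub that by auto
    note \<alpha>k = images[OF that]
    show ?thesis
    proof (rule quasi_isometry_submetric[OF V(1)[OF k] F.Y.component_subset[OF \<alpha>k(3)]
          \<alpha>k(1) lower[OF k] affine[OF k]])
      fix w assume w: "w \<in> ?W (\<alpha> k)"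
      show "\<exists>z\<in>?V k. mdist mY (f z) w \<le> A"
      proof
        \<comment> \<open>The coarse inverse stays in \<open>V k\<close> because \<open>k\<close> is
          matched, so it yields a near preimage inside the same component.\<close>
        show "g w \<in> ?V k" using \<alpha>k w by blast
        have "w \<in> mspace mY" using \<alpha>k w F.Y.component_subset by blast
        then show "mdist mY (f (g w)) w \<le> A" using F.fg[of w] A by linarith
      qed
    qed
  qed
  show ?thesis
  proof (rule exI[of _ I], rule exI[of _ J], rule exI[of _ \<alpha>],
      intro conjI exI[of _ A] ballI allI impI)
    show "0 < A" using A by simp
  qed (fact sub I J bij images lower upper onto_image onto_component)+
qed

end
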